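(* Let $A\in\mathbb{C}^{r\times r}$ be a positive stable matrix such that $A+kI$ is invertible for all integers $k\ge 0$. Let $x>0$ be real and $t\in\mathbb{C}$. Then $$e\big((x,t);A\big)=\Gamma^{-1}(A)\int_0^x v^{A-I}e^{-v}\Big(\sum_{m=0}^\infty (A)_m^{-1}\frac{(vt)^m}{m!}\Big)dv=\Gamma^{-1}(A)\int_0^x v^{A-I}e^{-v}\,{}_0F_1(-;A;vt)\,dv,$$ $$E\big((x,t);A\big)=\Gamma^{-1}(A)\int_x^\infty v^{A-I}e^{-v}\Big(\sum_{m=0}^\infty (A)_m^{-1}\frac{(vt)^m}{m!}\Big)dv=\Gamma^{-1}(A)\int_x^\infty v^{A-I}e^{-v}\,{}_0F_1(-;A;vt)\,dv.$$
   Context: $\mathbb{C}^{r\times r}$ is the space of complex $r\times r$ matrices and $I$ is the identity matrix. A matrix $M$ is positive stable if every eigenvalue of $M$ has positive real part. For real $v>0$, $v^{M}=\exp(M\ln v)$. For positive stable $M$, $\Gamma(M)=\int_0^\infty e^{-s}s^{M-I}ds$, and $\Gamma^{-1}(M)$ is its matrix inverse. For $x>0$ and $M$ positive stable, $\gamma(M,x)=\int_0^x e^{-s}s^{M-I}ds$ and $\Gamma(M,x)=\int_x^\infty e^{-s}s^{M-I}ds$. The Pochhammer symbol is $(M)_0=I$, $(M)_m=M(M+I)\cdots(M+(m-1)I)$ for $m\ge1$, and $(M)_m^{-1}$ is its matrix inverse. Also ${}_0F_1(-;A;z)=\sum_{m=0}^\infty (A)_m^{-1}\frac{z^m}{m!}$.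 The incomplete exponential matrix functions are $$e\big((x,t);A\big)=\sum_{m=0}^\infty \Gamma^{-1}(A+mI)\,\gamma(A+mI,x)\frac{t^m}{m!},\qquad E\big((x,t);A\big)=\sum_{m=0}^\infty \Gamma^{-1}(A+mI)\,\Gamma(A+mI,x)\frac{t^m}{m!}.$$ *)

theory Defs
  imports "HOL-Analysis.Analysis"
begin

text \<open>
  Complex square matrices are the elements of \<^typ>\<open>complex^'n^'n\<close>. On this type the operations
  \<open>*\<close>, \<open>^\<close> and \<open>1\<close> of the library are entrywise; the matrix product is \<open>**\<close>, the identity
  matrix is \<^term>\<open>mat 1\<close>, and \<^term>\<open>mat c\<close> is the scalar matrix with diagonal entries \<open>c\<close>.
\<close>

definition cscale :: "complex \<Rightarrow> complex^'n^'m \<Rightarrow> complex^'n^'m"  (infixr \<open>*\<^sub>M\<close> 75) where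
  "c *\<^sub>M M = (\<chi> i j. c * M $ i $ j)"

definition positive_stable :: "complex^'n^'n \<Rightarrow> bool" where
  "positive_stable M \<longleftrightarrow> (\<forall>l v. v \<noteq> 0 \<and> M *v v = l *s v \<longrightarrow> Re l > 0)"

primrec mpower :: "complex^'n^'n \<Rightarrow> nat \<Rightarrow> complex^'n^'n" where
  "mpower M 0 = mat 1"
| "mpower M (Suc k) = mpower M k ** M"

definition mexp :: "complex^'n^'n \<Rightarrow> complex^'n^'n" where
  "mexp M = (\<Sum>k. mpower M k /\<^sub>R fact k)"

definition mpowr :: "real \<Rightarrow> complex^'n^'n \<Rightarrow> complex^'n^'n" where
  "mpowr v M = mexp (ln v *\<^sub>R M)"

text \<open>
  The integrals are Lebesgue integrals over intervals without their finite end points, so that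
  \<^term>\<open>mpowr v M\<close> is only used for \<^prop>\<open>v > 0\<close>.
\<close>

definition mGamma :: "complex^'n^'n \<Rightarrow> complex^'n^'n" where
  "mGamma M = (LINT s:{0<..}|lborel. exp (- s) *\<^sub>R mpowr s (M - mat 1))"

definition lower_mGamma :: "complex^'n^'n \<Rightarrow> real \<Rightarrow> complex^'n^'n" where
  "lower_mGamma M x = (LINT s:{0<..<x}|lborel. exp (- s) *\<^sub>R mpowr s (M - mat 1))"

definition upper_mGamma :: "complex^'n^'n \<Rightarrow> real \<Rightarrow> complex^'n^'n" where
  "upper_mGamma M x = (LINT s:{x<..}|lborel. exp (- s) *\<^sub>R mpowr s (M - mat 1))"

primrec mpochhammer :: "complex^'n^'n \<Rightarrow> nat \<Rightarrow> complex^'n^'n" where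
  "mpochhammer M 0 = mat 1"
| "mpochhammer M (Suc m) = mpochhammer M m ** (M + mat (of_nat m))"

definition hyp0F1 :: "complex^'n^'n \<Rightarrow> complex \<Rightarrow> complex^'n^'n" where
  "hyp0F1 A z = (\<Sum>m. (z ^ m / fact m) *\<^sub>M matrix_inv (mpochhammer A m))"

text \<open>The functions \<open>e((x,t);A)\<close> and \<open>E((x,t);A)\<close>.\<close>

definition lower_inc_exp :: "real \<Rightarrow> complex \<Rightarrow> complex^'n^'n \<Rightarrow> complex^'n^'n" where
  "lower_inc_exp x t A =
     (\<Sum>m. (t ^ m / fact m) *\<^sub>M
        (matrix_inv (mGamma (A + mat (of_nat m))) ** lower_mGamma (A + mat (of_nat m)) x))"

definition upper_inc_exp :: "real \<Rightarrow> complex \<Rightarrow> complex^'n^'n \<Rightarrow> complex^'n^'n" where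
  "upper_inc_exp x t A =
     (\<Sum>m. (t ^ m / fact m) *\<^sub>M
        (matrix_inv (mGamma (A + mat (of_nat m))) ** upper_mGamma (A + mat (of_nat m)) x))"

end

theory Submission
  imports Defs "HOL-Computational_Algebra.Fundamental_Theorem_Algebra"
begin

text \<open>
  Integrating the series of \<open>\<^sub>0F\<^sub>1\<close> term by term turns the claim into
  \<open>\<Gamma>\<inverse>(A + m I) = \<Gamma>\<inverse>(A) (A)\<^sub>m\<inverse>\<close>. Besides the recursion \<open>\<Gamma>(A + I) = A \<Gamma>(A)\<close>, this needs
  that \<open>\<Gamma>(A)\<close> is invertible: otherwise its kernel, which is invariant under \<open>A\<close>, contains an
  eigenvector of \<open>A\<close>, on which \<open>\<Gamma>(A)\<close> acts as the nonzero scalar \<open>\<Gamma>(\<lambda>)\<close>. The integrals converge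
  at \<open>0\<close> because \<open>exp(-s A)\<close> decays exponentially; this is shown by splitting off one factor
  \<open>A - \<lambda> I\<close> of an annihilating polynomial at a time. The interchange of sum and integral is dominated
  by a multiple of \<open>e\<^bsup>-v/2\<^esup> \<parallel>v\<^bsup>A-I\<^esup>\<parallel>\<close>.
\<close>

section \<open>Matrix algebra\<close>

text \<open>Makes complex scaling a matrix product, so that scalars are moved by associativity and
  \<open>mat_commute\<close>.\<close>

lemma cscale_conv_mat: "c *\<^sub>M M = mat c ** M"
  by (simp add: cscale_def matrix_matrix_mult_def mat_def vec_eq_iff if_distrib if_distribR
      cong: if_cong)

lemma mat_commute: "mat c ** M = M ** mat c" for M :: "complex^'n^'n"
  by (simp add: matrix_matrix_mult_def mat_def vec_eq_iff if_distrib if_distribR mult.commute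
      cong: if_cong)

lemma mat_add: "mat (c + d) = mat c + (mat d :: complex^'n^'n)"
  by (simp add: mat_def vec_eq_iff)

lemma mat_mult: "mat (c * d) = mat c ** (mat d :: complex^'n^'n)"
  by (simp add: cscale_conv_mat[symmetric]) (simp add: cscale_def mat_def vec_eq_iff)

lemma scaleR_conv_cscale: "r *\<^sub>R M = of_real r *\<^sub>M M"
  by (simp add: cscale_def vec_eq_iff scaleR_conv_of_real[where 'a=complex])

lemma cscale_mult_left: "(c *\<^sub>M X) ** Y = c *\<^sub>M (X ** Y)"
  by (simp add: cscale_conv_mat matrix_mul_assoc)

lemma cscale_mult_right: "X ** (c *\<^sub>M Y) = c *\<^sub>M (X ** Y)"
  for X Y :: "complex^'n^'n"
  by (metis cscale_conv_mat matrix_mul_assoc mat_commute)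

lemma cscale_cscale: "c *\<^sub>M d *\<^sub>M X = (c * d) *\<^sub>M X"
  by (simp add: cscale_def vec_eq_iff)

lemma cscale_one [simp]: "1 *\<^sub>M X = X"
  by (simp add: cscale_def vec_eq_iff)

lemma cscale_vec: "(c *\<^sub>M X) *v w = c *s (X *v w)"
  by (simp add: cscale_def vec_eq_iff matrix_vector_mult_def sum_distrib_left mult_ac)

lemma mat_vec: "mat c *v w = c *s w" for w :: "complex^'n"
  by (simp add: mat_def vec_eq_iff matrix_vector_mult_def if_distrib if_distribR cong: if_cong)

text \<open>In finite dimension bilinearity implies boundedness. As a bounded bilinear map the
  product obeys the product rule and passes through series and integrals.\<close>

lemma bounded_bilinear_matrix_mult:
  "bounded_bilinear ((**) :: complex^'n^'n \<Rightarrow> complex^'n^'n \<Rightarrow> complex^'n^'n)"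
proof -
  have "bilinear ((**) :: complex^'n^'n \<Rightarrow> complex^'n^'n \<Rightarrow> complex^'n^'n)"
    unfolding bilinear_def
    by (auto intro!: linearI simp: matrix_add_ldistrib scaleR_conv_cscale cscale_mult_left
        cscale_mult_right)
       (simp add: matrix_matrix_mult_def vec_eq_iff sum.distrib distrib_right)
  then show ?thesis
    using bilinear_conv_bounded_bilinear by blast
qed

lemma bounded_bilinear_cscale:
  "bounded_bilinear (cscale :: complex \<Rightarrow> complex^'n^'n \<Rightarrow> complex^'n^'n)"
proof -
  have "bilinear (cscale :: complex \<Rightarrow> complex^'n^'n \<Rightarrow> complex^'n^'n)"
    unfolding bilinear_def
    by (auto intro!: linearI simp: cscale_def vec_eq_iff algebra_simps)
  then show ?thesis
    using bilinear_conv_bounded_bilinear by blast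
qed

lemma bounded_bilinear_matrix_vector:
  "bounded_bilinear ((*v) :: complex^'n^'n \<Rightarrow> complex^'n \<Rightarrow> complex^'n)"
proof -
  have "bilinear ((*v) :: complex^'n^'n \<Rightarrow> complex^'n \<Rightarrow> complex^'n)"
    unfolding bilinear_def
    by (auto intro!: linearI simp: matrix_vector_mult_add_rdistrib matrix_vector_right_distrib)
       (simp_all add: vec_eq_iff matrix_vector_mult_def scaleR_right.sum)
  then show ?thesis
    using bilinear_conv_bounded_bilinear by blast
qed

lemma bounded_linear_vector_smult: "bounded_linear (\<lambda>c::complex. c *s (u :: complex^'n))"
proof -
  have "linear (\<lambda>c::complex. c *s u)"
    by (auto intro!: linearI simp: vec_eq_iff algebra_simps)
  then show ?thesis by (simp add: linear_conv_bounded_linear)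
qed

lemmas matrix_mult_simps =
  bounded_bilinear.add_left[OF bounded_bilinear_matrix_mult]
  bounded_bilinear.add_right[OF bounded_bilinear_matrix_mult]
  bounded_bilinear.diff_left[OF bounded_bilinear_matrix_mult]
  bounded_bilinear.diff_right[OF bounded_bilinear_matrix_mult]
  bounded_bilinear.minus_left[OF bounded_bilinear_matrix_mult]
  bounded_bilinear.minus_right[OF bounded_bilinear_matrix_mult]
  bounded_bilinear.zero_left[OF bounded_bilinear_matrix_mult]
  bounded_bilinear.zero_right[OF bounded_bilinear_matrix_mult]
  bounded_bilinear.scaleR_left[OF bounded_bilinear_matrix_mult]
  bounded_bilinear.scaleR_right[OF bounded_bilinear_matrix_mult]

lemma norm_cscale: "norm (c *\<^sub>M X) = cmod c * norm X"
proof -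
  have "norm ((c *\<^sub>M X) $ i) = cmod c * norm (X $ i)" for i
    by (simp add: cscale_def norm_vec_def norm_mult L2_set_right_distrib)
  then show ?thesis
    by (simp add: norm_vec_def[of "c *\<^sub>M X"] norm_vec_def[of X] L2_set_right_distrib)
qed

text \<open>Stands in for submultiplicativity; the estimates below carry the constant
  \<open>K\<close> along.\<close>

lemma matrix_norm_bound:
  "\<exists>K>0. \<forall>(X :: complex^'n^'n) (Y :: complex^'n^'n). norm (X ** Y) \<le> K * norm X * norm Y"
  using bounded_bilinear.pos_bounded[OF bounded_bilinear_matrix_mult[where 'n='n]]
  by (metis mult.commute mult.assoc)

section \<open>Inverses and commuting matrices\<close>

lemma invertible_unique_inv:
  fixes A B :: "complex^'n^'n"
  assumes "A ** B = mat 1"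
  shows "invertible A" "matrix_inv A = B"
proof -
  have *: "B ** A = mat 1" using assms matrix_left_right_inverse by blast
  show inv: "invertible A" using assms * unfolding invertible_def by blast
  have "A ** matrix_inv A = mat 1 \<and> matrix_inv A ** A = mat 1"
    unfolding matrix_inv_def using inv[unfolded invertible_def] by (rule someI_ex)
  then show "matrix_inv A = B"
    using assms matrix_mul_assoc[of B A "matrix_inv A"] by (simp add: *)
qed

lemma matrix_inv_mult_self:
  fixes A :: "complex^'n^'n"
  assumes "invertible A"
  shows "A ** matrix_inv A = mat 1" "matrix_inv A ** A = mat 1"
proof -
  obtain B where B: "A ** B = mat 1" "B ** A = mat 1"
    using assms unfolding invertible_def by blast
  then show "A ** matrix_inv A = mat 1" "matrix_inv A ** A = mat 1"
    using invertible_unique_inv(2)[OF B(1)] by simp_all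
qed

lemma matrix_inv_mult:
  fixes A B :: "complex^'n^'n"
  assumes "invertible A" "invertible B"
  shows "invertible (A ** B)" "matrix_inv (A ** B) = matrix_inv B ** matrix_inv A"
proof -
  have "(A ** B) ** (matrix_inv B ** matrix_inv A) = A ** (B ** matrix_inv B) ** matrix_inv A"
    by (simp only: matrix_mul_assoc)
  then have "(A ** B) ** (matrix_inv B ** matrix_inv A) = mat 1"
    by (simp add: matrix_inv_mult_self assms)
  then show "invertible (A ** B)" "matrix_inv (A ** B) = matrix_inv B ** matrix_inv A"
    by (rule invertible_unique_inv)+
qed

lemma commute_matrix_inv:
  fixes A X :: "complex^'n^'n"
  assumes "invertible A" "X ** A = A ** X"
  shows "X ** matrix_inv A = matrix_inv A ** X"
proof -
  have "X ** matrix_inv A = matrix_inv A ** (A ** X) ** matrix_inv A"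
    by (simp add: matrix_mul_assoc matrix_inv_mult_self assms(1))
  also have "\<dots> = matrix_inv A ** X ** (A ** matrix_inv A)"
    by (simp only: assms(2)[symmetric] matrix_mul_assoc)
  finally show ?thesis
    by (simp add: matrix_inv_mult_self assms(1))
qed

lemma commute_diff_mat:
  fixes M X :: "complex^'n^'n"
  assumes "X ** M = M ** X"
  shows "X ** (M - mat c) = (M - mat c) ** X"
  by (simp add: matrix_mult_simps assms mat_commute)

lemma commute_add_mat:
  fixes M X :: "complex^'n^'n"
  assumes "X ** M = M ** X"
  shows "X ** (M + mat c) = (M + mat c) ** X"
  by (simp add: matrix_mult_simps assms mat_commute)

lemma commute_mpower:
  assumes "X ** M = M ** X"
  shows "X ** mpower M k = mpower M k ** X"
proof (induction k)
  case (Suc k)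
  then have "X ** mpower M (Suc k) = mpower M k ** (X ** M)"
    by (simp add: matrix_mul_assoc)
  then show ?case
    by (simp add: assms matrix_mul_assoc)
qed simp

section \<open>The matrix exponential\<close>

lemma mpower_norm_bound:
  assumes K: "\<And>(X :: complex^'n^'n) (Y :: complex^'n^'n). norm (X ** Y) \<le> K * norm X * norm Y" "K > 0"
  shows "norm (mpower (M :: complex^'n^'n) k) \<le> norm (mat 1 :: complex^'n^'n) * (K * norm M) ^ k"
proof (induction k)
  case (Suc k)
  have "norm (mpower M (Suc k)) \<le> K * norm (mpower M k) * norm M"
    using K(1) by simp
  also have "\<dots> \<le> K * (norm (mat 1 :: complex^'n^'n) * (K * norm M) ^ k) * norm M"
    using K(2) Suc by (intro mult_right_mono mult_left_mono) auto
  finally show ?case by (simp add: mult_ac)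
qed simp

text \<open>Comparison with the scalar exponential series at \<open>K * norm M\<close>. The factor
  \<open>norm (mat 1)\<close> comes from the zeroth power, since the identity need not have norm
  1.\<close>

lemma mexp_bounds:
  assumes K: "\<And>(X :: complex^'n^'n) (Y :: complex^'n^'n). norm (X ** Y) \<le> K * norm X * norm Y" "K > 0"
  shows "summable (\<lambda>k. norm (mpower (M :: complex^'n^'n) k /\<^sub>R fact k))"
    and "norm (mexp M) \<le> norm (mat 1 :: complex^'n^'n) * exp (K * norm M)"
proof -
  let ?g = "\<lambda>k. norm (mat 1 :: complex^'n^'n) * ((K * norm M) ^ k /\<^sub>R fact k)"
  have g: "?g sums (norm (mat 1 :: complex^'n^'n) * exp (K * norm M))"
    by (intro sums_mult exp_converges)
  have le: "norm (mpower M k /\<^sub>R fact k) \<le> ?g k" for k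
    using mpower_norm_bound[OF K, of M k]
    by (simp add: divide_simps mult_ac)
  show 1: "summable (\<lambda>k. norm (mpower (M :: complex^'n^'n) k /\<^sub>R fact k))"
    by (rule summable_comparison_test'[OF sums_summable[OF g], where N=0]) (use le in simp)
  have "norm (mexp M) \<le> (\<Sum>k. norm (mpower M k /\<^sub>R fact k))"
    unfolding mexp_def by (rule summable_norm[OF 1])
  also have "\<dots> \<le> suminf ?g"
    by (rule suminf_le[OF le 1 sums_summable[OF g]])
  finally show "norm (mexp M) \<le> norm (mat 1 :: complex^'n^'n) * exp (K * norm M)"
    using sums_unique[OF g] by simp
qed

lemma mexp_sums: "(\<lambda>k. mpower M k /\<^sub>R fact k) sums mexp (M :: complex^'n^'n)"
proof -
  obtain K where K: "K > 0" "\<forall>(X :: complex^'n^'n) (Y :: complex^'n^'n). norm (X ** Y) \<le> K * norm X * norm Y"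
    using matrix_norm_bound[where 'n='n] by (elim exE conjE)
  have "summable (\<lambda>k. norm (mpower M k /\<^sub>R fact k))"
    by (rule mexp_bounds(1)[where K=K]) (use K in auto)
  then show ?thesis
    unfolding mexp_def by (rule summable_sums[OF summable_norm_cancel])
qed

lemma mexp_zero [simp]: "mexp 0 = mat 1"
proof -
  have eq: "mpower 0 k /\<^sub>R fact k = (if k = 0 then mat 1 else 0 :: complex^'n^'n)" for k
    by (cases k) (simp_all add: matrix_mult_simps)
  then have "(\<lambda>k. if k = 0 then mat 1 else 0) sums mexp (0 :: complex^'n^'n)"
    using mexp_sums[of "0 :: complex^'n^'n"] by (simp only: eq)
  moreover have "(\<lambda>k. if k = 0 then mat 1 else (0 :: complex^'n^'n)) sums mat 1"
    using sums_single[of 0 "\<lambda>_. mat 1 :: complex^'n^'n"] by simp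
  ultimately show ?thesis by (rule sums_unique2)
qed

lemma commute_mexp:
  fixes X M :: "complex^'n^'n"
  assumes "X ** M = M ** X"
  shows "X ** mexp M = mexp M ** X"
proof -
  have "(\<lambda>k. X ** (mpower M k /\<^sub>R fact k)) sums (X ** mexp M)"
    by (rule bounded_linear.sums[OF bounded_bilinear.bounded_linear_right
          [OF bounded_bilinear_matrix_mult] mexp_sums])
  moreover have "(\<lambda>k. (mpower M k /\<^sub>R fact k) ** X) sums (mexp M ** X)"
    by (rule bounded_linear.sums[OF bounded_bilinear.bounded_linear_left
          [OF bounded_bilinear_matrix_mult] mexp_sums])
  ultimately show ?thesis
    by (simp add: matrix_mult_simps commute_mpower[OF assms] sums_iff)
qed

lemma mpower_scaleR: "mpower (s *\<^sub>R M) k = s ^ k *\<^sub>R mpower (M :: complex^'n^'n) k"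
  by (induction k) (simp_all add: matrix_mult_simps)

lemma mexp_eigenvector:
  fixes M :: "complex^'n^'n"
  assumes "M *v u = l *s u"
  shows "mexp (s *\<^sub>R M) *v u = exp (of_real s * l) *s u"
proof -
  have pow: "mpower M k *v u = l ^ k *s u" for k
    by (induction k) (simp_all add: matrix_vector_mul_assoc[symmetric] assms
        vector_smult_assoc mult_ac cscale_vec[symmetric] vec.scale)
  have "(\<lambda>k. ((of_real s * l) ^ k /\<^sub>R fact k) *s u) sums (exp (of_real s * l) *s u)"
    by (rule bounded_linear.sums[OF bounded_linear_vector_smult exp_converges])
  moreover have "(\<lambda>k. (mpower (s *\<^sub>R M) k /\<^sub>R fact k) *v u) sums (mexp (s *\<^sub>R M) *v u)"
    by (rule bounded_linear.sums[OF bounded_bilinear.bounded_linear_left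
          [OF bounded_bilinear_matrix_vector] mexp_sums])
  moreover have eq: "(mpower (s *\<^sub>R M) k /\<^sub>R fact k) *v u = ((of_real s * l) ^ k /\<^sub>R fact k) *s u" for k
    unfolding mpower_scaleR scaleR_scaleR
    unfolding scaleR_conv_cscale cscale_vec pow
    by (simp add: power_mult_distrib vector_smult_assoc scaleR_conv_of_real[where 'a=complex] mult_ac)
  ultimately show ?thesis
    unfolding eq by (metis sums_unique2)
qed

section \<open>The exponential as the solution of a differential equation\<close>

lemma has_vector_derivative_matrixI:
  fixes F :: "real \<Rightarrow> complex^'n^'m"
  assumes "\<And>i j. ((\<lambda>s. F s $ i $ j) has_vector_derivative F' $ i $ j) (at s)"
  shows "(F has_vector_derivative F') (at s)"
  unfolding has_vector_derivative_def
proof (subst has_derivative_componentwise_within, intro ballI)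
  fix b :: "complex^'n^'m" assume "b \<in> Basis"
  \<comment> \<open>A basis vector of the matrix space is supported on one entry, so the inner
    product with it sees only that entry.\<close>
  then obtain i j u where b: "b = axis i (axis j u)"
    by (auto simp: Basis_vec_def)
  have "((\<lambda>s. F s $ i $ j \<bullet> u) has_derivative (\<lambda>h. (h *\<^sub>R F' $ i $ j) \<bullet> u)) (at s)"
    using assms[of i j] unfolding has_vector_derivative_def
    by (rule has_derivative_inner_left)
  then show "((\<lambda>s. F s \<bullet> b) has_derivative (\<lambda>h. h *\<^sub>R F' \<bullet> b)) (at s)"
    by (simp add: b inner_axis)
qed

text \<open>Every entry is an everywhere convergent power series; it is differentiated termwise in a
  complex variable and then restricted to the real line.\<close>

lemma mexp_has_vector_derivative:
  fixes M :: "complex^'n^'n"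
  shows "((\<lambda>s. mexp (s *\<^sub>R M)) has_vector_derivative (M ** mexp (s *\<^sub>R M))) (at s)"
proof (rule has_vector_derivative_matrixI)
  fix i j
  define c where "c = (\<lambda>k. mpower M k $ i $ j / fact k)"
  have ent: "bounded_linear (\<lambda>X :: complex^'n^'n. X $ i $ j)"
    using bounded_linear_compose[OF bounded_linear_vec_nth bounded_linear_vec_nth] .
  have ser: "(\<lambda>k. c k * (of_real r) ^ k) sums (mexp (r *\<^sub>R M) $ i $ j)" for r
    using bounded_linear.sums[OF ent mexp_sums[of "r *\<^sub>R M"]]
    by (simp add: mpower_scaleR c_def scaleR_conv_of_real[where 'a=complex] divide_inverse mult_ac)
  \<comment> \<open>Convergence at the real point \<open>cmod z + 1\<close>, whose modulus exceeds
    that of \<open>z\<close>, gives convergence at \<open>z\<close>.\<close>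
  have sm: "summable (\<lambda>k. c k * z ^ k)" for z :: complex
    by (rule powser_insidea[THEN summable_norm_cancel, OF sums_summable[OF ser[of "cmod z + 1"]]])
       (simp add: abs_of_nonneg)
  have "((\<lambda>z. \<Sum>k. c k * z ^ k) has_field_derivative (\<Sum>k. diffs c k * of_real s ^ k))
          (at (of_real s))"
    by (rule termdiffs_strong_converges_everywhere[OF sm])
  then have "((\<lambda>r. \<Sum>k. c k * of_real r ^ k) has_vector_derivative (\<Sum>k. diffs c k * of_real s ^ k))
          (at s)"
    by (rule has_vector_derivative_real_field)
  moreover have "(\<lambda>k. diffs c k * of_real s ^ k) sums ((M ** mexp (s *\<^sub>R M)) $ i $ j)"
  proof -
    have "bounded_linear (\<lambda>X. (M ** X) $ i $ j)"
      using bounded_linear_compose[OF ent bounded_bilinear.bounded_linear_right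
          [OF bounded_bilinear_matrix_mult]] .
    from bounded_linear.sums[OF this mexp_sums[of "s *\<^sub>R M"]]
    have "(\<lambda>k. (M ** (mpower (s *\<^sub>R M) k /\<^sub>R fact k)) $ i $ j) sums ((M ** mexp (s *\<^sub>R M)) $ i $ j)" .
    \<comment> \<open>\<open>diffs\<close> contributes the factor k + 1 that reduces the factorial
      of k + 1; the factor \<open>M\<close> is moved past the power.\<close>
    moreover have "(M ** (mpower (s *\<^sub>R M) k /\<^sub>R fact k)) $ i $ j = diffs c k * of_real s ^ k" for k
      by (simp add: mpower_scaleR matrix_mult_simps commute_mpower[OF refl] c_def diffs_def
          scaleR_conv_of_real[where 'a=complex] field_simps del: of_nat_Suc)
    ultimately show ?thesis by simp
  qed
  ultimately show "((\<lambda>r. mexp (r *\<^sub>R M) $ i $ j) has_vector_derivative (M ** mexp (s *\<^sub>R M)) $ i $ j) (at s)"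
    using ser by (simp add: sums_iff)
qed

text \<open>For every solution \<open>H\<close> with initial value \<open>mat 1\<close>, the product
  of exp(-s M) and \<open>H s\<close> has derivative 0 and equals \<open>mat 1\<close> at 0. Hence
  \<open>G s\<close> and exp(s M) are inverses of the same matrix.\<close>

lemma mexp_ode_unique:
  fixes M :: "complex^'n^'n" and G :: "real \<Rightarrow> complex^'n^'n"
  assumes G: "\<And>s. (G has_vector_derivative (M ** G s)) (at s)" and "G 0 = mat 1"
  shows "G s = mexp (s *\<^sub>R M)"
proof -
  define P where "P = (\<lambda>s. mexp (s *\<^sub>R - M))"
  have inv: "P s ** H s = mat 1"
    if H: "\<And>s. (H has_vector_derivative (M ** H s)) (at s)" and "H 0 = mat 1" for H s
  proof -
    have "((\<lambda>s. P s ** H s) has_vector_derivative 0) (at s)" for s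
    proof -
      have "((\<lambda>s. P s ** H s) has_vector_derivative (P s ** (M ** H s) + (- M ** P s) ** H s)) (at s)"
        unfolding P_def
        by (intro bounded_bilinear.has_vector_derivative[OF bounded_bilinear_matrix_mult] H
            mexp_has_vector_derivative)
      moreover have "M ** P s = P s ** M"
        unfolding P_def by (intro commute_mexp) (simp add: matrix_mult_simps)
      ultimately show ?thesis by (simp add: matrix_mult_simps matrix_mul_assoc)
    qed
    then obtain c where "\<And>s. P s ** H s = c"
      using has_vector_derivative_zero_constant[of UNIV "\<lambda>s. P s ** H s"] by auto
    moreover have "P 0 ** H 0 = mat 1" by (simp add: P_def that)
    ultimately show ?thesis by metis
  qed
  have 1: "P s ** G s = mat 1" by (intro inv assms)
  have 2: "P s ** mexp (s *\<^sub>R M) = mat 1"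
    by (intro inv mexp_has_vector_derivative) simp
  show ?thesis
    by (metis 1 2 invertible_unique_inv(2))
qed

text \<open>The rule exp(X + Y) = exp(X) exp(Y) for scalar Y. Multiplied by exp(-s c), the left side
  solves the differential equation of exp(s M), so \<open>mexp_ode_unique\<close> applies. This is
  the source of v^(M + m I) = v^m v^M.\<close>

lemma mexp_shift:
  fixes M :: "complex^'n^'n"
  shows "mexp (s *\<^sub>R (M + mat c)) = exp (of_real s * c) *\<^sub>M mexp (s *\<^sub>R M)"
proof -
  define G where "G = (\<lambda>s. exp (of_real s * - c) *\<^sub>M mexp (s *\<^sub>R (M + mat c)))"
  have e: "((\<lambda>s. exp (of_real s * - c)) has_vector_derivative exp (of_real s * - c) * - c) (at s)" for s
    by (rule has_vector_derivative_real_field) (auto intro!: derivative_eq_intros)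
  have "(G has_vector_derivative (M ** G s)) (at s)" for s
  proof -
    have "(G has_vector_derivative (exp (of_real s * - c) *\<^sub>M ((M + mat c) ** mexp (s *\<^sub>R (M + mat c)))
            + (exp (of_real s * - c) * - c) *\<^sub>M mexp (s *\<^sub>R (M + mat c)))) (at s)"
      unfolding G_def
      by (intro bounded_bilinear.has_vector_derivative[OF bounded_bilinear_cscale] e
          mexp_has_vector_derivative)
    also have "exp (of_real s * - c) *\<^sub>M ((M + mat c) ** mexp (s *\<^sub>R (M + mat c)))
            + (exp (of_real s * - c) * - c) *\<^sub>M mexp (s *\<^sub>R (M + mat c)) = M ** G s"
      by (simp add: G_def matrix_mult_simps cscale_mult_right cscale_conv_mat[symmetric])
         (simp add: cscale_def vec_eq_iff algebra_simps)
    finally show ?thesis .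
  qed
  then have "G s = mexp (s *\<^sub>R M)"
    by (rule mexp_ode_unique) (simp add: G_def)
  then have "exp (of_real s * c) *\<^sub>M mexp (s *\<^sub>R M)
      = (exp (of_real s * c) * exp (of_real s * - c)) *\<^sub>M mexp (s *\<^sub>R (M + mat c))"
    unfolding G_def by (metis cscale_cscale)
  then show ?thesis by (simp flip: exp_add)
qed

section \<open>Annihilating products and eigenvectors\<close>

text \<open>Horner's scheme for p(A), written out with \<open>mat\<close> and \<open>**\<close>
  because \<open>*\<close> on matrices is entrywise.\<close>

definition meval :: "complex^'n^'n \<Rightarrow> complex poly \<Rightarrow> complex^'n^'n" where
  "meval A p = fold_coeffs (\<lambda>a X. mat a + X ** A) p 0"

lemma mat_zero [simp]: "mat 0 = (0 :: complex^'n^'n)"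
  by (simp add: mat_def vec_eq_iff)

lemma meval_0 [simp]: "meval A 0 = 0"
  by (simp add: meval_def)

lemma meval_pCons [simp]: "meval A (pCons a p) = mat a + meval A p ** A"
  by (cases "p = 0 \<and> a = 0") (auto simp: meval_def matrix_mult_simps)

lemma meval_add: "meval A (p + q) = meval A p + meval A q"
  by (induction p q rule: poly_induct2) (simp_all add: mat_add matrix_mult_simps)

lemma meval_smult: "meval A (smult c p) = mat c ** meval A p"
  by (induction p) (simp_all add: mat_mult matrix_mult_simps matrix_mul_assoc)

lemma meval_monom: "meval A (monom c k) = mat c ** mpower A k"
  by (induction k) (simp_all add: monom_Suc monom_0 matrix_mul_assoc matrix_mult_simps)

lemma meval_linear_factor: "meval A ([:- l, 1:] * q) = meval A q ** (A - mat l)"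
proof -
  have neg: "mat (- l) = - (mat l :: complex^'n^'n)"
    by (simp add: mat_def vec_eq_iff)
  have "[:- l, 1:] * q = smult (- l) q + pCons 0 q"
    by simp
  then have "meval A ([:- l, 1:] * q) = mat (- l) ** meval A q + meval A q ** A"
    by (simp only: meval_add meval_smult meval_pCons mat_zero add_0_left)
  then show ?thesis
    by (simp add: neg matrix_mult_simps mat_commute[of l])
qed

text \<open>The head of the list is the rightmost factor, hence the first to act on what stands to
  the right. The inductions over the list rely on this order.\<close>

primrec mroots :: "complex^'n^'n \<Rightarrow> complex list \<Rightarrow> complex^'n^'n" where
  "mroots A [] = mat 1"
| "mroots A (l # ls) = mroots A ls ** (A - mat l)"

text \<open>The fundamental theorem of algebra supplies a root; splitting it off lowers the degree
  by one.\<close>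

lemma meval_factor:
  assumes "p \<noteq> 0"
  shows "\<exists>c ls. c \<noteq> 0 \<and> meval A p = mat c ** mroots A ls"
  using assms
proof (induction "degree p" arbitrary: p)
  case 0
  then obtain c where "p = [:c:]"
    by (metis degree_eq_zeroE)
  then have "c \<noteq> 0 \<and> meval A p = mat c ** mroots A []"
    using 0 by (simp add: matrix_mult_simps)
  then show ?case by blast
next
  case (Suc n)
  then have "\<not> constant (poly p)"
    by (simp add: constant_degree)
  then obtain z where "poly p z = 0"
    using fundamental_theorem_of_algebra by blast
  then obtain q where q: "p = [:- z, 1:] * q"
    by (metis poly_eq_0_iff_dvd dvdE)
  have "q \<noteq> 0" using Suc.prems q by auto
  moreover have "n = degree q"
    using Suc.hyps(2) \<open>q \<noteq> 0\<close> unfolding q by (subst (asm) degree_mult_eq) auto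
  ultimately obtain c ls where "c \<noteq> 0" "meval A q = mat c ** mroots A ls"
    using Suc.hyps(1) by blast
  then have "c \<noteq> 0 \<and> meval A p = mat c ** mroots A (z # ls)"
    unfolding q meval_linear_factor by (simp add: matrix_mul_assoc)
  then show ?case by blast
qed

text \<open>The powers of \<open>A\<close> are linearly dependent already over the reals.\<close>

lemma exists_annihilating_poly: "\<exists>p. p \<noteq> 0 \<and> meval (A :: complex^'n^'n) p = 0"
proof -
  define N where "N = DIM(complex^'n^'n)"
  show ?thesis
  \<comment> \<open>If two powers coincide, the difference of their monomials annihilates
    \<open>A\<close>. Otherwise N + 1 distinct matrices lie in a real space of dimension N and are
    dependent.\<close>
  proof (cases "inj_on (mpower A) {..N}")
    case False
    then obtain i j where ij: "i \<noteq> j" "mpower A i = mpower A j"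
      unfolding inj_on_def by blast
    let ?p = "monom 1 i + monom (-1) j :: complex poly"
    have "coeff ?p i \<noteq> 0" using ij by simp
    then have "?p \<noteq> 0" by force
    moreover have "meval A ?p = 0"
      using ij(2) by (simp add: meval_add meval_monom cscale_conv_mat[symmetric])
        (simp add: cscale_def vec_eq_iff)
    ultimately show ?thesis by blast
  next
    case True
    let ?S = "mpower A ` {..N}"
    have "card ?S = Suc N" using True by (simp add: card_image)
    then have "dependent ?S"
      by (intro dependent_biggerset) (simp add: N_def)
    then obtain u where u: "\<exists>v\<in>?S. u v \<noteq> 0" "(\<Sum>v\<in>?S. u v *\<^sub>R v) = 0"
      using dependent_finite[of ?S] by auto
    define p where "p = (\<Sum>i\<le>N. monom (complex_of_real (u (mpower A i))) i)"
    have "coeff p i = of_real (u (mpower A i))" if "i \<le> N" for i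
      using that by (simp add: p_def coeff_sum if_distrib cong: if_cong)
    then have "p \<noteq> 0" using u(1) by force
    moreover have "meval A p = (\<Sum>i\<le>N. u (mpower A i) *\<^sub>R mpower A i)"
    proof -
      have "meval A (\<Sum>i\<in>I. f i) = (\<Sum>i\<in>I. meval A (f i))" if "finite I"
        for I :: "nat set" and f
        using that by (induction I) (simp_all add: meval_add)
      then show ?thesis
        by (simp add: p_def meval_monom scaleR_conv_cscale cscale_conv_mat)
    qed
    moreover have "\<dots> = 0"
      using u(2) by (simp add: sum.reindex[OF True])
    ultimately show ?thesis by metis
  qed
qed

lemma exists_annihilating_roots: "\<exists>ls. mroots (A :: complex^'n^'n) ls = 0"
proof -
  obtain p where p: "p \<noteq> 0" "meval A p = 0"
    using exists_annihilating_poly by blast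
  obtain c ls where c: "c \<noteq> 0" "meval A p = mat c ** mroots A ls"
    using meval_factor[OF p(1)] by blast
  have "mroots A ls = mat (1 / c) ** (mat c ** mroots A ls)"
    using c(1) by (simp add: matrix_mul_assoc mat_mult[symmetric])
  then have "mroots A ls = 0"
    using c p by (simp add: matrix_mult_simps)
  then show ?thesis by blast
qed

lemma not_invertible_kernel:
  fixes M :: "complex^'n^'n"
  assumes "\<not> invertible M"
  shows "\<exists>w. w \<noteq> 0 \<and> M *v w = 0"
  using assms matrix_left_invertible_ker[of M] invertible_left_inverse[of M] by blast

text \<open>The factors of an annihilating product are applied one by one to a nonzero kernel vector
  of \<open>G\<close>. The result stays in the kernel because \<open>G\<close> commutes with each
  factor. As the whole product gives 0, some factor is the first to do so, and the vector it kills
  is the eigenvector.\<close>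

lemma commuting_kernel_eigenvector:
  fixes A G :: "complex^'n^'n"
  assumes GA: "G ** A = A ** G" and "\<not> invertible G"
  shows "\<exists>u l. u \<noteq> 0 \<and> G *v u = 0 \<and> A *v u = l *s u"
proof -
  have "\<exists>u l. u \<noteq> 0 \<and> G *v u = 0 \<and> A *v u = l *s u"
    if "mroots A ls *v w = 0" "w \<noteq> 0" "G *v w = 0" for ls w
    using that
  proof (induction ls arbitrary: w)
    case (Cons l ls)
    show ?case
    proof (cases "(A - mat l) *v w = 0")
      case True
      then have "A *v w = l *s w"
        by (simp add: matrix_vector_mult_diff_rdistrib mat_vec)
      with Cons.prems show ?thesis by blast
    next
      case False
      have "G *v ((A - mat l) *v w) = (A - mat l) *v (G *v w)"
        by (simp add: matrix_vector_mul_assoc commute_diff_mat[OF GA])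
      with Cons.prems have "G *v ((A - mat l) *v w) = 0" by simp
      with False Cons.prems Cons.IH[of "(A - mat l) *v w"] show ?thesis
        by (simp add: matrix_vector_mul_assoc)
    qed
  qed simp
  moreover obtain ls where "mroots A ls = 0"
    using exists_annihilating_roots by blast
  moreover obtain w where "w \<noteq> 0" "G *v w = 0"
    using not_invertible_kernel[OF assms(2)] by blast
  ultimately show ?thesis by (metis matrix_vector_mult_0)
qed

section \<open>Decay of the exponential of a positive stable matrix\<close>

text \<open>The matrix \<open>W\<close> makes the induction possible: U = (A - l I) W is annihilated
  by the remaining factors, so exp(-s A) U decays by hypothesis. If A - l I is invertible,
  \<open>W\<close> is recovered from \<open>U\<close>. Otherwise \<open>l\<close> is an eigenvalue
  with positive real part, and exp(l s) exp(-s A) W is estimated through its derivative -exp(l s)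
  exp(-s A) U.\<close>

lemma mexp_decay_aux:
  fixes A W :: "complex^'n^'n"
  assumes st: "positive_stable A" and "mroots A ls ** W = 0"
  shows "\<exists>C d. d > 0 \<and> (\<forall>s\<ge>0. norm (mexp (s *\<^sub>R - A) ** W) \<le> C * exp (- d * s))"
  using assms(2)
proof (induction ls arbitrary: W)
  case Nil
  then have "W = 0" by simp
  then have "(1::real) > 0 \<and> (\<forall>s\<ge>0. norm (mexp (s *\<^sub>R - A) ** W) \<le> 0 * exp (- 1 * s))"
    by (simp add: matrix_mult_simps)
  then show ?case by blast
next
  case (Cons l ls)
  define P where "P = (\<lambda>s. mexp (s *\<^sub>R - A))"
  have PA: "A ** P s = P s ** A" for s
    unfolding P_def by (rule commute_mexp) (simp add: matrix_mult_simps)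
  define U where "U = (A - mat l) ** W"
  have "mroots A ls ** U = 0" using Cons.prems by (simp add: U_def matrix_mul_assoc)
  from Cons.IH[OF this] obtain C d where d: "d > 0"
    and C: "\<And>s. s \<ge> 0 \<Longrightarrow> norm (P s ** U) \<le> C * exp (- d * s)"
    unfolding P_def by blast
  have "0 \<le> norm (P 0 ** U)" by (rule norm_ge_zero)
  also have "\<dots> \<le> C" using C[of 0] by simp
  finally have C0: "C \<ge> 0" .
  show ?case
  proof (cases "invertible (A - mat l)")
    case True
    let ?B = "matrix_inv (A - mat l)"
    obtain K where K: "K > 0" "\<forall>(X :: complex^'n^'n) (Y :: complex^'n^'n). norm (X ** Y) \<le> K * norm X * norm Y"
      using matrix_norm_bound[where 'n='n] by (elim exE conjE)
    have BP: "P s ** ?B = ?B ** P s" for s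
      by (rule commute_matrix_inv[OF True commute_diff_mat[OF PA[symmetric]]])
    have "W = ?B ** U"
      by (simp add: U_def matrix_mul_assoc matrix_inv_mult_self[OF True])
    then have eq: "P s ** W = ?B ** (P s ** U)" for s
      using BP[of s] by (simp add: matrix_mul_assoc)
    have "norm (P s ** W) \<le> (K * norm ?B * C) * exp (- d * s)" if "s \<ge> 0" for s
    proof -
      have "norm (P s ** W) \<le> K * norm ?B * norm (P s ** U)"
        unfolding eq using K by blast
      also have "\<dots> \<le> K * norm ?B * (C * exp (- d * s))"
        using K(1) C[OF that] by (intro mult_left_mono) auto
      finally show ?thesis by (simp add: mult_ac)
    qed
    with d show ?thesis unfolding P_def by blast
  next
    case False
    then obtain w where w: "w \<noteq> 0" "(A - mat l) *v w = 0"
      using not_invertible_kernel by blast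
    then have "A *v w = l *s w"
      by (simp add: matrix_vector_mult_diff_rdistrib mat_vec)
    with st w(1) have l: "Re l > 0" unfolding positive_stable_def by blast
    \<comment> \<open>The new rate is at most \<open>d\<close> and strictly below
      \<open>Re l\<close>. Strictness makes \<open>a\<close> positive and so avoids the linear
      growth that would appear for d = Re l.\<close>
    define e where "e = min d (Re l) / 2"
    have e: "e > 0" "e \<le> d" "e < Re l" using d l by (auto simp: e_def)
    define g where "g = (\<lambda>s. exp (of_real s * l) *\<^sub>M (P s ** W))"
    have g': "(g has_vector_derivative - (exp (of_real s * l) *\<^sub>M (P s ** U))) (at s within T)" for s T
    proof -
      have 1: "((\<lambda>s. exp (of_real s * l)) has_vector_derivative exp (of_real s * l) * l) (at s)"
        by (rule has_vector_derivative_real_field) (auto intro!: derivative_eq_intros)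
      have 2: "((\<lambda>s. P s ** W) has_vector_derivative (- A ** P s) ** W) (at s)"
        unfolding P_def
        by (rule bounded_linear.has_vector_derivative[OF bounded_bilinear.bounded_linear_left
              [OF bounded_bilinear_matrix_mult] mexp_has_vector_derivative])
      have "(g has_vector_derivative exp (of_real s * l) *\<^sub>M ((- A ** P s) ** W)
           + (exp (of_real s * l) * l) *\<^sub>M (P s ** W)) (at s)"
        unfolding g_def
        by (rule bounded_bilinear.has_vector_derivative[OF bounded_bilinear_cscale 1 2])
      \<comment> \<open>Writing A = (A - l I) + l I produces \<open>U\<close> and a multiple of
        \<open>W\<close> that cancels the derivative of the scalar exponential.\<close>
      also have "(- A ** P s) ** W = - (P s ** U) - l *\<^sub>M (P s ** W)"
        by (simp add: U_def matrix_mult_simps PA cscale_conv_mat[symmetric] cscale_mult_right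
            matrix_mul_assoc)
      also have "exp (of_real s * l) *\<^sub>M (- (P s ** U) - l *\<^sub>M (P s ** W))
           + (exp (of_real s * l) * l) *\<^sub>M (P s ** W) = - (exp (of_real s * l) *\<^sub>M (P s ** U))"
        by (simp add: cscale_def vec_eq_iff algebra_simps)
      finally show ?thesis by (rule has_vector_derivative_at_within)
    qed
    define a where "a = Re l - e"
    have a: "a > 0" using e by (simp add: a_def)
    \<comment> \<open>An antiderivative of the bound \<open>C * exp (a * s)\<close> for the
      derivative of \<open>g\<close>, as the mean value inequality requires.\<close>
    define \<phi> where "\<phi> = (\<lambda>s. C / a * exp (a * s))"
    have \<phi>': "(\<phi> has_vector_derivative C * exp (a * s)) (at s within T)" for s T
      unfolding \<phi>_def using a
      by (auto intro!: derivative_eq_intros simp flip: has_real_derivative_iff_has_vector_derivative)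
    have "norm (P s ** W) \<le> (norm (g 0) + C / a) * exp (- e * s)" if "s \<ge> 0" for s
    proof (cases "s = 0")
      case True
      have "g 0 = P 0 ** W" by (simp add: g_def)
      then show ?thesis using True C0 a by simp
    next
      case False
      with that have s: "0 < s" by simp
      have "norm (g s - g 0) \<le> \<phi> s - \<phi> 0"
      proof (rule differentiable_bound_general[OF s])
        show "continuous_on {0..s} g"
          by (rule continuous_on_vector_derivative[OF g'])
        show "continuous_on {0..s} \<phi>"
          by (rule continuous_on_vector_derivative[OF \<phi>'])
        fix r assume r: "0 < r" "r < s"
        show "(g has_vector_derivative - (exp (of_real r * l) *\<^sub>M (P r ** U))) (at r)" by (rule g')
        show "(\<phi> has_vector_derivative C * exp (a * r)) (at r)" by (rule \<phi>')
        have "norm (- (exp (of_real r * l) *\<^sub>M (P r ** U))) = exp (r * Re l) * norm (P r ** U)"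
          by (simp add: norm_cscale)
        also have "\<dots> \<le> exp (r * Re l) * (C * exp (- d * r))"
          using C[of r] r by (intro mult_left_mono) auto
        also have "\<dots> = C * exp (r * Re l + - d * r)" unfolding exp_add by (simp only: mult_ac)
        also have "\<dots> \<le> C * exp (a * r)"
          using C0 e r by (intro mult_left_mono) (auto simp: a_def algebra_simps)
        finally show "norm (- (exp (of_real r * l) *\<^sub>M (P r ** U))) \<le> C * exp (a * r)" .
      qed
      then have "norm (g s) \<le> norm (g 0) + C / a * exp (a * s)"
        using divide_nonneg_pos[OF C0 a] norm_triangle_sub[of "g s" "g 0"]
        by (simp add: \<phi>_def)
      then have "exp (s * Re l) * norm (P s ** W) \<le> norm (g 0) + C / a * exp (a * s)"
        by (simp add: g_def norm_cscale)
      \<comment> \<open>Since a s > 0, the constant is absorbed into the exponential; dividing by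
        exp(s Re l) then leaves the rate \<open>e\<close>.\<close>
      also have "\<dots> \<le> norm (g 0) * exp (a * s) + C / a * exp (a * s)"
        using a s by (simp add: mult_le_cancel_left1)
      also have "\<dots> = (norm (g 0) + C / a) * exp (- e * s) * exp (s * Re l)"
        by (simp add: a_def exp_diff exp_minus algebra_simps divide_inverse)
      finally show ?thesis by (simp add: mult.commute)
    qed
    with e(1) show ?thesis unfolding P_def by blast
  qed
qed

lemma mexp_decay:
  assumes "positive_stable (A :: complex^'n^'n)"
  shows "\<exists>C d. d > 0 \<and> (\<forall>s\<ge>0. norm (mexp (s *\<^sub>R - A)) \<le> C * exp (- d * s))"
proof -
  obtain ls where "mroots A ls = 0"
    using exists_annihilating_roots by blast
  then show ?thesis
    using mexp_decay_aux[OF assms, of ls "mat 1"] by simp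
qed

section \<open>Real powers with matrix exponent\<close>

lemma mpowr_add_nat:
  assumes "v > 0"
  shows "mpowr v (M + mat (of_nat m)) = v ^ m *\<^sub>R mpowr v (M :: complex^'n^'n)"
proof -
  have "exp (complex_of_real (ln v) * of_nat m) = of_real (v ^ m)"
    using assms by (simp flip: exp_of_real add: mult.commute exp_of_nat_mult)
      (simp add: exp_of_real)
  then show ?thesis
    by (simp add: mpowr_def mexp_shift scaleR_conv_cscale[of "v ^ m"])
qed

lemma mpowr_diff_one:
  assumes "v > 0"
  shows "mpowr v (M - mat 1) = (1 / v) *\<^sub>R mpowr v (M :: complex^'n^'n)"
  using mpowr_add_nat[OF assms, of "M - mat 1" 1] assms by simp

lemma commute_mpowr:
  fixes X M :: "complex^'n^'n"
  assumes "X ** M = M ** X"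
  shows "X ** mpowr v M = mpowr v M ** X"
  unfolding mpowr_def by (rule commute_mexp) (simp add: matrix_mult_simps assms)

lemma mpowr_has_vector_derivative:
  assumes "v > 0"
  shows "((\<lambda>v. mpowr v M) has_vector_derivative (M ** mpowr v (M - mat 1))) (at v)"
proof -
  have "(ln has_vector_derivative (1 / v)) (at v)"
    using assms by (auto intro!: derivative_eq_intros
        simp flip: has_real_derivative_iff_has_vector_derivative)
  from vector_diff_chain_at[OF this mexp_has_vector_derivative[of M "ln v"]]
  show ?thesis
    using assms by (simp add: mpowr_def[abs_def] o_def mpowr_diff_one[unfolded mpowr_def] matrix_mult_simps)
qed

lemma isCont_mpowr: "v > 0 \<Longrightarrow> isCont (\<lambda>v. mpowr v M) v"
  using mpowr_has_vector_derivative has_vector_derivative_continuous by blast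

lemma continuous_on_mpowr: "continuous_on {0<..} (\<lambda>v. mpowr v M)"
  by (auto intro!: continuous_at_imp_continuous_on isCont_mpowr)

text \<open>For v \<le> 1 the decay of exp(-s M) is used at s = -ln v, where exp(-d s) = v^d. For v
  \<ge> 1 the crude bound of the exponential is already a power of v.\<close>

lemma mpowr_bounds:
  fixes M :: "complex^'n^'n"
  assumes "positive_stable M"
  shows "\<exists>C d n. d > 0 \<and> n > 0 \<and> (\<forall>v. 0 < v \<and> v \<le> 1 \<longrightarrow> norm (mpowr v M) \<le> C * v powr d) \<and>
            (\<forall>v\<ge>1. norm (mpowr v M) \<le> C * v ^ n)"
proof -
  obtain C d where d: "d > 0" "\<forall>s\<ge>0. norm (mexp (s *\<^sub>R - M)) \<le> C * exp (- d * s)"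
    using mexp_decay[OF assms] by blast
  obtain K where K: "K > 0" "\<forall>(X :: complex^'n^'n) (Y :: complex^'n^'n). norm (X ** Y) \<le> K * norm X * norm Y"
    using matrix_norm_bound[where 'n='n] by (elim exE conjE)
  define D where "D = max C (norm (mat 1 :: complex^'n^'n))"
  \<comment> \<open>\<open>Suc\<close> ensures n > 0, so that \<open>real n\<close> is an admissible
    argument of the Gamma integral.\<close>
  define n where "n = Suc (nat \<lceil>K * norm M\<rceil>)"
  have "norm (mpowr v M) \<le> D * v powr d" if "0 < v" "v \<le> 1" for v
  proof -
    have "norm (mpowr v M) \<le> C * exp (- d * - ln v)"
      using d(2)[rule_format, of "- ln v"] that by (simp add: mpowr_def)
    also have "\<dots> = C * v powr d" using that by (simp add: powr_def)
    also have "\<dots> \<le> D * v powr d" by (intro mult_right_mono) (auto simp: D_def)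
    finally show ?thesis .
  qed
  moreover have "norm (mpowr v M) \<le> D * v ^ n" if "v \<ge> 1" for v
  proof -
    have "norm (mpowr v M) \<le> norm (mat 1 :: complex^'n^'n) * exp (K * norm (ln v *\<^sub>R M))"
      unfolding mpowr_def by (rule mexp_bounds(2)) (use K in auto)
    also have "\<dots> = norm (mat 1 :: complex^'n^'n) * v powr (K * norm M)"
      using that by (simp add: powr_def mult_ac)
    also have "\<dots> \<le> norm (mat 1 :: complex^'n^'n) * v powr real n"
    proof (intro mult_left_mono powr_mono)
      show "K * norm M \<le> real n" unfolding n_def by linarith
    qed (use that in auto)
    also have "\<dots> \<le> D * v powr real n" by (intro mult_right_mono) (auto simp: D_def)
    finally show ?thesis using that by (simp add: powr_realpow)
  qed
  ultimately show ?thesis using d(1) by (intro exI[of _ D] exI[of _ d] exI[of _ n]) (simp add: n_def)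
qed

section \<open>The matrix Gamma function\<close>

lemma set_integral_bounded_linear:
  assumes "bounded_linear T" "set_integrable M S f"
  shows "set_integrable M S (\<lambda>s. T (f s))" "(LINT s:S|M. T (f s)) = T (LINT s:S|M. f s)"
proof -
  have eq: "(\<lambda>s. indicat_real S s *\<^sub>R T (f s)) = (\<lambda>s. T (indicat_real S s *\<^sub>R f s))"
    by (simp add: linear_cmul[OF bounded_linear.linear[OF assms(1)]])
  show "set_integrable M S (\<lambda>s. T (f s))"
    using integrable_bounded_linear[OF assms(1) assms(2)[unfolded set_integrable_def]]
    by (simp add: set_integrable_def eq)
  show "(LINT s:S|M. T (f s)) = T (LINT s:S|M. f s)"
    using integral_bounded_linear[OF assms(1) assms(2)[unfolded set_integrable_def]]
    by (simp add: set_lebesgue_integral_def eq)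
qed

text \<open>Euler's integrand is absolutely integrable for the completed measure; continuity gives
  the Borel measurability needed to return to \<open>lborel\<close>.\<close>

lemma set_integrable_powr_exp:
  assumes "Re z > 0" "c > 0"
  shows "set_integrable lborel {0<..} (\<lambda>s. complex_of_real s powr (z - 1) / of_real (exp (c * s)))"
    (is "set_integrable _ _ ?f")
proof -
  have "continuous_on {0<..} ?f"
    by (intro continuous_intros) (auto simp: complex_nonpos_Reals_iff)
  then have "(\<lambda>s. indicat_real {0<..} s *\<^sub>R ?f s) \<in> borel_measurable lborel"
    using borel_measurable_continuous_on_indicator[of "{0<..}" ?f] by simp
  then show ?thesis
    using absolutely_integrable_Gamma_integral[OF assms]
    unfolding set_integrable_def by (subst (asm) integrable_completion) auto
qed

text \<open>Two scalar Gamma integrands dominate: the exponent \<open>d\<close> controls the origin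
  and \<open>n\<close> controls infinity. The rate \<open>c\<close> is free because the interchange
  of sum and integral needs c = 1/2.\<close>

lemma set_integrable_mGamma:
  fixes M :: "complex^'n^'n"
  assumes "positive_stable M" "c > 0"
  shows "set_integrable lborel {0<..} (\<lambda>s. exp (- (c * s)) *\<^sub>R mpowr s (M - mat 1))"
proof -
  obtain C d n where d: "d > 0" "n > 0"
    and small: "\<And>v. 0 < v \<Longrightarrow> v \<le> 1 \<Longrightarrow> norm (mpowr v M) \<le> C * v powr d"
    and large: "\<And>v. v \<ge> 1 \<Longrightarrow> norm (mpowr v M) \<le> C * v ^ n"
    using mpowr_bounds[OF assms(1)] by blast
  have "norm (mpowr 1 M) \<le> C" using small[of 1] by simp
  then have C: "C \<ge> 0" using norm_ge_zero order_trans by blast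
  \<comment> \<open>Kept as the norm of a complex integrand, so that
    \<open>set_integrable_powr_exp\<close> applies directly; fact \<open>g\<close> gives the real
    form.\<close>
  let ?g = "\<lambda>a s. norm (complex_of_real s powr (of_real a - 1) / of_real (exp (c * s)))"
  let ?h = "\<lambda>s. C * (?g d s + ?g (real n) s)"
  have g: "?g a s = s powr (a - 1) * exp (- (c * s))" if "s > 0" for a s
    using that by (simp add: norm_divide norm_powr_real_powr) (simp add: exp_minus divide_inverse)
  have "set_integrable lborel {0<..} (?g d)" "set_integrable lborel {0<..} (?g (real n))"
    by (rule set_integrable_norm, rule set_integrable_powr_exp; use assms d in simp)+
  then have h: "set_integrable lborel {0<..} ?h"
    by (intro set_integrable_mult_right set_integral_add)
  have "continuous_on {0<..} (\<lambda>s. exp (- (c * s)) *\<^sub>R mpowr s (M - mat 1))"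
    by (intro continuous_intros continuous_on_mpowr)
  then have meas: "set_borel_measurable lborel {0<..} (\<lambda>s. exp (- (c * s)) *\<^sub>R mpowr s (M - mat 1))"
    unfolding set_borel_measurable_def
    using borel_measurable_continuous_on_indicator[of "{0<..}"
        "\<lambda>s. exp (- (c * s)) *\<^sub>R mpowr s (M - mat 1)"]
    by (simp del: scaleR_scaleR)
  have "norm (exp (- (c * s)) *\<^sub>R mpowr s (M - mat 1)) \<le> norm (?h s)" if "s > 0" for s
  proof -
    have le: "norm (mpowr s M) / s \<le> C * (s powr (d - 1) + s powr (real n - 1))"
    proof (cases "s \<le> 1")
      case True
      then have "norm (mpowr s M) / s \<le> C * s powr d / s"
        using small[OF that] that by (intro divide_right_mono) auto
      also have "\<dots> = C * s powr (d - 1)" using that by (simp add: powr_diff)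
      also have "\<dots> \<le> C * (s powr (d - 1) + s powr (real n - 1))"
        using C by (intro mult_left_mono) auto
      finally show ?thesis .
    next
      case False
      then have "norm (mpowr s M) / s \<le> C * s ^ n / s"
        using large[of s] that by (intro divide_right_mono) auto
      also have "\<dots> = C * s powr (real n - 1)" using that by (simp add: powr_diff powr_realpow)
      also have "\<dots> \<le> C * (s powr (d - 1) + s powr (real n - 1))"
        using C by (intro mult_left_mono) auto
      finally show ?thesis .
    qed
    have "norm (exp (- (c * s)) *\<^sub>R mpowr s (M - mat 1)) = exp (- (c * s)) * (norm (mpowr s M) / s)"
      using that by (simp add: mpowr_diff_one)
    also have "\<dots> \<le> exp (- (c * s)) * (C * (s powr (d - 1) + s powr (real n - 1)))"
      using le by (intro mult_left_mono) auto
    also have "\<dots> = ?h s" unfolding g[OF that] by (simp add: algebra_simps)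
    finally show ?thesis by simp
  qed
  then show ?thesis
    by (intro set_integrable_bound[OF h meas]) auto
qed

section \<open>Invertibility and recursion of the Gamma function\<close>

lemma commute_mGamma:
  fixes X M :: "complex^'n^'n"
  assumes "positive_stable M" "X ** M = M ** X"
  shows "X ** mGamma M = mGamma M ** X"
proof -
  have int: "set_integrable lborel {0<..} (\<lambda>s. exp (- s) *\<^sub>R mpowr s (M - mat 1))"
    using set_integrable_mGamma[OF assms(1), of 1] by simp
  have "X ** (exp (- s) *\<^sub>R mpowr s (M - mat 1)) = (exp (- s) *\<^sub>R mpowr s (M - mat 1)) ** X" for s
    by (simp add: matrix_mult_simps commute_mpowr[OF commute_diff_mat[OF assms(2)]])
  then show ?thesis
    unfolding mGamma_def
    by (simp flip: set_integral_bounded_linear(2)[OF bounded_bilinear.bounded_linear_left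
          [OF bounded_bilinear_matrix_mult] int]
        set_integral_bounded_linear(2)[OF bounded_bilinear.bounded_linear_right
          [OF bounded_bilinear_matrix_mult] int])
qed

text \<open>On \<open>u\<close> the power s^(M - I) acts as the scalar s^(l - 1), so the matrix
  integral collapses to Euler's integral.\<close>

lemma mGamma_eigenvector:
  fixes M :: "complex^'n^'n"
  assumes st: "positive_stable M" and u: "u \<noteq> 0" "M *v u = l *s u"
  shows "mGamma M *v u = Gamma l *s u"
proof -
  have l: "Re l > 0" using assms unfolding positive_stable_def by blast
  have int: "set_integrable lborel {0<..} (\<lambda>s. exp (- s) *\<^sub>R mpowr s (M - mat 1))"
    using set_integrable_mGamma[OF st, of 1] by simp
  let ?f = "\<lambda>s. complex_of_real s powr (l - 1) / of_real (exp s)"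
  have f: "set_integrable lborel {0<..} ?f"
    using set_integrable_powr_exp[OF l, of 1] by simp
  have "(M - mat 1) *v u = (l - 1) *s u"
    using u by (simp add: matrix_vector_mult_diff_rdistrib vec_eq_iff algebra_simps)
  then have pow: "mpowr s (M - mat 1) *v u = exp (of_real (ln s) * (l - 1)) *s u" for s
    unfolding mpowr_def by (rule mexp_eigenvector)
  have eq: "(exp (- s) *\<^sub>R mpowr s (M - mat 1)) *v u = ?f s *s u" if "s > 0" for s
  proof -
    have "?f s = of_real (exp (- s)) * exp (of_real (ln s) * (l - 1))"
      using that by (simp add: powr_def Ln_of_real exp_minus divide_inverse mult_ac)
    then show ?thesis
      by (simp only: scaleR_conv_cscale cscale_vec pow vector_smult_assoc)
  qed
  have "mGamma M *v u = (LINT s:{0<..}|lborel. (exp (- s) *\<^sub>R mpowr s (M - mat 1)) *v u)"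
    unfolding mGamma_def
    by (rule set_integral_bounded_linear(2)[OF bounded_bilinear.bounded_linear_left
          [OF bounded_bilinear_matrix_vector] int, symmetric])
  also have "\<dots> = (LINT s:{0<..}|lborel. ?f s *s u)"
    by (rule set_lebesgue_integral_cong) (auto simp: eq)
  also have "\<dots> = (LINT s:{0<..}|lborel. ?f s) *s u"
    by (rule set_integral_bounded_linear(2)[OF bounded_linear_vector_smult f])
  also have "(LINT s:{0<..}|lborel. ?f s) = Gamma l"
    using set_borel_integral_eq_integral(2)[OF f] Gamma_integral_complex'[OF l]
    by (simp add: integral_unique)
  finally show ?thesis .
qed

lemma invertible_mGamma:
  fixes M :: "complex^'n^'n"
  assumes st: "positive_stable M"
  shows "invertible (mGamma M)"
proof (rule ccontr)
  assume "\<not> invertible (mGamma M)"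
  then obtain u l where u: "u \<noteq> 0" "mGamma M *v u = 0" "M *v u = l *s u"
    using commuting_kernel_eigenvector[OF commute_mGamma[OF st refl, symmetric]] by blast
  have "Re l > 0" using st u unfolding positive_stable_def by blast
  \<comment> \<open>\<open>Gamma\<close> takes the value 0 only at its poles, by convention; a
    positive real part excludes them.\<close>
  then have "Gamma l \<noteq> 0"
    by (auto simp: Gamma_eq_zero_iff elim!: nonpos_Ints_cases)
  moreover have "Gamma l *s u = 0"
    using mGamma_eigenvector[OF st u(1,3)] u(2) by simp
  ultimately show False using u(1) by (simp add: vec_eq_iff)
qed

text \<open>Integration by parts: F(v) = exp(-v) v^M has derivative f1 - F and vanishes at both
  ends, so \<open>f1\<close> and \<open>F\<close> have equal integrals. Assumption
  \<open>st1\<close> gives the integrability of \<open>F\<close>.\<close>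

lemma mGamma_plus_one:
  fixes M :: "complex^'n^'n"
  assumes st: "positive_stable M" and st1: "positive_stable (M + mat 1)"
  shows "mGamma (M + mat 1) = M ** mGamma M"
proof -
  obtain C d n where d: "d > 0" "n > 0"
    and small: "\<And>v. 0 < v \<Longrightarrow> v \<le> 1 \<Longrightarrow> norm (mpowr v M) \<le> C * v powr d"
    and large: "\<And>v. v \<ge> 1 \<Longrightarrow> norm (mpowr v M) \<le> C * v ^ n"
    using mpowr_bounds[OF st] by blast
  define F where "F = (\<lambda>v. exp (- v) *\<^sub>R mpowr v M)"
  define f1 where "f1 = (\<lambda>v. M ** (exp (- v) *\<^sub>R mpowr v (M - mat 1)))"
  have int: "set_integrable lborel {0<..} (\<lambda>s. exp (- s) *\<^sub>R mpowr s (M - mat 1))"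
    using set_integrable_mGamma[OF st, of 1] by simp
  have intF: "set_integrable lborel {0<..} F"
    using set_integrable_mGamma[OF st1, of 1] by (simp add: F_def)
  note lin = set_integral_bounded_linear[OF bounded_bilinear.bounded_linear_right
          [OF bounded_bilinear_matrix_mult] int, of M]
  have int1: "set_integrable lborel {0<..} f1"
    unfolding f1_def by (rule lin(1))
  have ev: "einterval (ereal 0) \<infinity> = {0<..}" by (auto simp: einterval_def)
  \<comment> \<open>The two zeros are the limits of \<open>F\<close> at infinity and at 0.\<close>
  have "(LBINT v=ereal 0..\<infinity>. f1 v - F v) = 0 - 0"
  proof (rule interval_integral_FTC_integrable[where F = F])
    fix v assume "ereal 0 < ereal v"
    then have v: "v > 0" by simp
    have "((\<lambda>v. exp (- v)) has_vector_derivative - exp (- v)) (at v)"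
      by (auto intro!: derivative_eq_intros simp flip: has_real_derivative_iff_has_vector_derivative)
    from bounded_bilinear.has_vector_derivative[OF bounded_bilinear_scaleR this mpowr_has_vector_derivative[OF v]]
    show "(F has_vector_derivative f1 v - F v) (at v)"
      by (simp add: F_def f1_def matrix_mult_simps)
    show "isCont (\<lambda>v. f1 v - F v) v"
      unfolding F_def f1_def
      by (intro continuous_intros isCont_mpowr v bounded_linear.isCont[OF
            bounded_bilinear.bounded_linear_right[OF bounded_bilinear_matrix_mult]])
  next
    show "set_integrable lborel (einterval (ereal 0) \<infinity>) (\<lambda>v. f1 v - F v)"
      unfolding ev by (rule set_integral_diff(1)[OF int1 intF])
    have "(F \<longlongrightarrow> 0) (at_right 0)"
    proof (rule Lim_null_comparison)
      show "\<forall>\<^sub>F v in at_right 0. norm (F v) \<le> C * v powr d"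
      proof (rule eventually_at_rightI[of 0 1])
        fix v :: real assume v: "v \<in> {0<..<1}"
        then have "norm (F v) \<le> 1 * norm (mpowr v M)"
          unfolding F_def norm_scaleR by (intro mult_right_mono) auto
        then show "norm (F v) \<le> C * v powr d" using small[of v] v by simp
      qed simp
      have "((\<lambda>v::real. v powr d) \<longlongrightarrow> 0) (at_right 0)"
        by (rule tendsto_zero_powrI[where b = d])
           (use d in \<open>auto simp: eventually_at_right_less intro!: tendsto_intros eventually_at_rightI[of 0 1]\<close>)
      then show "((\<lambda>v. C * v powr d) \<longlongrightarrow> 0) (at_right 0)"
        by (rule tendsto_mult_right_zero)
    qed
    then show "((F \<circ> real_of_ereal) \<longlongrightarrow> 0) (at_right (ereal 0))"
      by (simp add: ereal_tendsto_simps1)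
    have "(F \<longlongrightarrow> 0) at_top"
    proof (rule Lim_null_comparison)
      show "\<forall>\<^sub>F v in at_top. norm (F v) \<le> C * (v ^ n / exp v)"
        using eventually_ge_at_top[of 1]
      proof eventually_elim
        case (elim v)
        have "norm (F v) \<le> exp (- v) * (C * v ^ n)"
          unfolding F_def norm_scaleR using large[OF elim] by (intro mult_mono) auto
        then show ?case by (simp add: exp_minus field_simps)
      qed
      show "((\<lambda>v. C * (v ^ n / exp v)) \<longlongrightarrow> 0) at_top"
        by (intro tendsto_mult_right_zero tendsto_power_div_exp_0)
    qed
    then show "((F \<circ> real_of_ereal) \<longlongrightarrow> 0) (at_left \<infinity>)"
      by (simp add: ereal_tendsto_simps1)
  qed simp
  then have "(LINT v:{0<..}|lborel. f1 v - F v) = 0"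
    unfolding interval_lebesgue_integral_def ev by simp
  then have "(LINT v:{0<..}|lborel. f1 v) = (LINT v:{0<..}|lborel. F v)"
    using set_integral_diff(2)[OF int1 intF] by simp
  then show ?thesis
    using lin(2) by (simp add: mGamma_def F_def f1_def)
qed

section \<open>Integer shifts and the Pochhammer symbol\<close>

lemma positive_stable_add_nat:
  assumes "positive_stable A"
  shows "positive_stable (A + mat (of_nat m))"
  unfolding positive_stable_def
proof (intro allI impI)
  fix l w assume w: "w \<noteq> 0 \<and> (A + mat (of_nat m)) *v w = l *s w"
  then have "A *v w + of_nat m *s w = l *s w"
    by (simp add: matrix_vector_mult_add_rdistrib mat_vec)
  then have "A *v w = (l - of_nat m) *s w"
    by (simp add: vector_sub_rdistrib eq_diff_eq)
  with assms w have "Re (l - of_nat m) > 0" unfolding positive_stable_def by blast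
  then show "Re l > 0" by (simp add: order.strict_trans1[OF of_nat_0_le_iff])
qed

lemma commute_mpochhammer:
  fixes X A :: "complex^'n^'n"
  assumes "X ** A = A ** X"
  shows "X ** mpochhammer A m = mpochhammer A m ** X"
proof (induction m)
  case (Suc m)
  then have "X ** mpochhammer A (Suc m) = mpochhammer A m ** (X ** (A + mat (of_nat m)))"
    by (simp add: matrix_mul_assoc)
  then show ?case
    by (simp add: commute_add_mat[OF assms] matrix_mul_assoc)
qed simp

lemma mGamma_add_nat:
  assumes "positive_stable A"
  shows "mGamma (A + mat (of_nat m)) = mpochhammer A m ** mGamma (A :: complex^'n^'n)"
proof (induction m)
  case (Suc m)
  let ?B = "A + mat (of_nat m)"
  have B: "A + mat (of_nat (Suc m)) = ?B + mat 1"
    by (simp add: mat_add add.assoc add.commute)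
  have "mGamma (?B + mat 1) = ?B ** mGamma ?B"
    using positive_stable_add_nat[OF assms, of "Suc m"] unfolding B
    by (intro mGamma_plus_one positive_stable_add_nat assms)
  \<comment> \<open>The recursion puts the new factor on the left, \<open>mpochhammer\<close> on the
    right; they agree because everything is built from \<open>A\<close>.\<close>
  also have "\<dots> = mpochhammer A (Suc m) ** mGamma A"
    using commute_mpochhammer[OF commute_add_mat[OF refl, symmetric], of A "of_nat m" m]
    by (simp add: Suc.IH matrix_mul_assoc)
  finally show ?case unfolding B .
qed simp

lemma invertible_mpochhammer:
  fixes A :: "complex^'n^'n"
  assumes "\<forall>k::nat. invertible (A + mat (of_nat k))"
  shows "invertible (mpochhammer A m)"
proof (induction m)
  case 0
  show ?case by (simp add: invertible_unique_inv(1)[of _ "mat 1"])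
next
  case (Suc m)
  then show ?case using assms by (simp add: matrix_inv_mult(1))
qed

text \<open>This holds for every \<open>\<epsilon>\<close> because the factors \<open>(A + m I)\<inverse>\<close> tend to \<open>0\<close>.\<close>

lemma matrix_inv_mpochhammer_bound:
  fixes A :: "complex^'n^'n"
  assumes inv: "\<forall>k::nat. invertible (A + mat (of_nat k))" and \<epsilon>: "\<epsilon> > 0"
  shows "\<exists>C. \<forall>m. norm (matrix_inv (mpochhammer A m)) \<le> C * \<epsilon> ^ m"
proof -
  let ?I = "mat 1 :: complex^'n^'n"
  obtain K where K0: "K > 0" and K: "\<forall>(X :: complex^'n^'n) (Y :: complex^'n^'n). norm (X ** Y) \<le> K * norm X * norm Y"
    using matrix_norm_bound[where 'n='n] by (elim exE conjE)
  define B where "B = (\<lambda>k::nat. matrix_inv (A + mat (of_nat k)))"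
  have "?I \<noteq> 0" by (simp add: mat_def vec_eq_iff)
  then have I: "norm ?I > 0" by simp
  \<comment> \<open>From (A + k I) B_k = I follows norm(B_k) (k - K norm(A)) \<le> norm(I). The
    threshold makes the bracket at least K norm(I) / \<epsilon>.\<close>
  obtain N :: nat where N: "real N \<ge> K * norm A + K * norm ?I / \<epsilon>"
    using real_arch_simple by blast
  have B: "K * norm (B k) \<le> \<epsilon>" if "k \<ge> N" for k
  proof -
    have "(A + mat (of_nat k)) ** B k = ?I"
      unfolding B_def by (rule matrix_inv_mult_self(1)) (use inv in blast)
    then have "of_nat k *\<^sub>M B k = ?I - A ** B k"
      by (simp add: matrix_mult_simps cscale_conv_mat eq_diff_eq add.commute)
    then have "real k * norm (B k) = norm (?I - A ** B k)"
      by (metis norm_cscale norm_of_nat)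
    also have "\<dots> \<le> norm ?I + K * norm A * norm (B k)"
      using norm_triangle_ineq4[of ?I "A ** B k"] K by (meson add_left_mono order_trans)
    finally have "norm (B k) * (real k - K * norm A) \<le> norm ?I"
      by (simp add: algebra_simps)
    moreover have "norm (B k) * (K * norm ?I / \<epsilon>) \<le> norm (B k) * (real k - K * norm A)"
      using N that by (intro mult_left_mono) auto
    ultimately have "norm (B k) * (K * norm ?I / \<epsilon>) \<le> norm ?I"
      by linarith
    then have "K * norm (B k) * norm ?I \<le> \<epsilon> * norm ?I"
      using \<epsilon> by (simp add: field_simps)
    then show ?thesis using I by simp
  qed
  \<comment> \<open>From index N on these quotients decrease, so the first N + 1 of them bound all;
    their sum serves in place of the maximum.\<close>
  define b where "b = (\<lambda>m. norm (matrix_inv (mpochhammer A m)) / \<epsilon> ^ m)"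
  have b0: "b m \<ge> 0" for m using \<epsilon> by (simp add: b_def)
  have step: "b (Suc m) \<le> b m" if "m \<ge> N" for m
  proof -
    have "matrix_inv (mpochhammer A (Suc m)) = B m ** matrix_inv (mpochhammer A m)"
      using inv by (simp add: B_def matrix_inv_mult(2) invertible_mpochhammer)
    then have "norm (matrix_inv (mpochhammer A (Suc m))) \<le> K * norm (B m) * norm (matrix_inv (mpochhammer A m))"
      using K by simp
    also have "\<dots> \<le> \<epsilon> * norm (matrix_inv (mpochhammer A m))"
      using B[OF that] by (intro mult_right_mono) auto
    finally show ?thesis using \<epsilon> by (simp add: b_def field_simps del: mpochhammer.simps)
  qed
  have "b m \<le> (\<Sum>i\<le>N. b i)" for m
  proof (cases "m \<le> N")
    case True
    then show ?thesis using b0 by (intro member_le_sum) auto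
  next
    case False
    then have "N \<le> m" by simp
    then have "b m \<le> b N"
      by (induction m rule: dec_induct) (use step order_trans in blast)+
    also have "\<dots> \<le> (\<Sum>i\<le>N. b i)" using b0 by (intro member_le_sum) auto
    finally show ?thesis .
  qed
  then have "norm (matrix_inv (mpochhammer A m)) \<le> (\<Sum>i\<le>N. b i) * \<epsilon> ^ m" for m
    using \<epsilon> by (simp add: b_def field_simps)
  then show ?thesis by blast
qed

section \<open>Termwise integration\<close>

text \<open>Treats both functions at once: \<open>S\<close> is the interval below x for one and
  above x for the other. Each summand becomes the inverse of Gamma(A) times the integral of
  \<open>f m\<close>, and dominated convergence is applied to the partial sums.\<close>

lemma incomplete_exp_sums:
  fixes A :: "complex^'n^'n" and t :: complex
  assumes st: "positive_stable A" and inv: "\<forall>k::nat. invertible (A + mat (of_nat k))"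
    and S: "S \<in> sets lborel" "S \<subseteq> {0<..}"
  shows "(\<lambda>m. (t ^ m / fact m) *\<^sub>M (matrix_inv (mGamma (A + mat (of_nat m))) **
            (LINT s:S|lborel. exp (- s) *\<^sub>R mpowr s (A + mat (of_nat m) - mat 1))))
          sums (matrix_inv (mGamma A) **
            (LINT v:S|lborel. (exp (- v) *\<^sub>R mpowr v (A - mat 1)) ** hyp0F1 A (of_real v * t)))"
proof -
  define P where "P = (\<lambda>m. matrix_inv (mpochhammer A m))"
  define G' where "G' = matrix_inv (mGamma A)"
  define k where "k = (\<lambda>v. exp (- v) *\<^sub>R mpowr v (A - mat 1))"
  define f where "f = (\<lambda>m v. k v ** (((of_real v * t) ^ m / fact m) *\<^sub>M P m))"
  define F where "F = (\<lambda>v. k v ** hyp0F1 A (of_real v * t))"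
  obtain K where K0: "K > 0" and K: "\<forall>(X :: complex^'n^'n) (Y :: complex^'n^'n). norm (X ** Y) \<le> K * norm X * norm Y"
    using matrix_norm_bound[where 'n='n] by (elim exE conjE)
  \<comment> \<open>Chosen so that the series at v is dominated by exp(v/2), which costs only half
    of exp(-v). The added 1 covers t = 0.\<close>
  define \<epsilon> where "\<epsilon> = 1 / (2 * (cmod t + 1))"
  have \<epsilon>: "\<epsilon> > 0" "\<epsilon> * cmod t \<le> 1 / 2"
    by (auto simp: \<epsilon>_def field_simps add_pos_nonneg)
  obtain C where C: "norm (P m) \<le> C * \<epsilon> ^ m" for m
    using matrix_inv_mpochhammer_bound[OF inv \<epsilon>(1)] unfolding P_def by blast
  have "norm (P 0) \<le> C" using C[of 0] by simp
  then have C0: "C \<ge> 0" using norm_ge_zero order_trans by blast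

  \<comment> \<open>The inverse Pochhammer symbol arises to the left of the integral but stands to
    the right of v^(A - I) in the claim.\<close>
  have Pk: "P m ** k v = k v ** P m" for m v
  proof -
    have "k v ** A = A ** k v"
      by (simp add: k_def matrix_mult_simps commute_mpowr[OF commute_diff_mat[OF refl], symmetric])
    then show ?thesis
      unfolding P_def
      by (rule commute_matrix_inv[OF invertible_mpochhammer[OF inv] commute_mpochhammer, symmetric])
  qed

  have termwise: "set_integrable lborel S (f m)"
    "(t ^ m / fact m) *\<^sub>M (matrix_inv (mGamma (A + mat (of_nat m))) **
            (LINT s:S|lborel. exp (- s) *\<^sub>R mpowr s (A + mat (of_nat m) - mat 1)))
       = G' ** (LINT v:S|lborel. f m v)" for m
  proof -
    define q where "q = (\<lambda>v. exp (- v) *\<^sub>R mpowr v (A + mat (of_nat m) - mat 1))"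
    define T where "T = (\<lambda>X :: complex^'n^'n. (t ^ m / fact m) *\<^sub>M (P m ** X))"
    have "set_integrable lborel {0<..} q"
      unfolding q_def using set_integrable_mGamma[OF positive_stable_add_nat[OF st], of 1] by simp
    then have q: "set_integrable lborel S q"
      by (rule set_integrable_subset[OF _ S])
    have T: "bounded_linear T"
      unfolding T_def
      by (rule bounded_linear_compose[where f = "cscale (t ^ m / fact m)" and g = "(**) (P m)"])
         (rule bounded_bilinear.bounded_linear_right[OF bounded_bilinear_cscale]
            bounded_bilinear.bounded_linear_right[OF bounded_bilinear_matrix_mult])+
    \<comment> \<open>The shift of the exponent by m I releases v^m, which joins t^m to form (v
      t)^m.\<close>
    have eq: "T (q v) = f m v" if "v \<in> S" for v
    proof -
      have v: "v > 0" using that S by auto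
      have shift: "A + mat (of_nat m) - mat 1 = A - mat 1 + mat (of_nat m)" by simp
      have "q v = v ^ m *\<^sub>R k v"
        unfolding q_def k_def shift mpowr_add_nat[OF v] by (simp add: mult.commute)
      then have "T (q v) = (t ^ m / fact m) *\<^sub>M of_real (v ^ m) *\<^sub>M (k v ** P m)"
        unfolding T_def by (simp only: scaleR_conv_cscale cscale_mult_right Pk)
      then show ?thesis
        by (simp add: f_def cscale_cscale cscale_mult_right power_mult_distrib mult_ac)
    qed
    note lin = set_integral_bounded_linear[OF T q]
    show "set_integrable lborel S (f m)"
      using lin(1) S(1) by (subst set_integrable_cong[OF refl refl eq[symmetric]]) auto
    have "mGamma (A + mat (of_nat m)) = mpochhammer A m ** mGamma A"
      by (rule mGamma_add_nat[OF st])
    \<comment> \<open>Inversion reverses the order, which leaves the inverse of Gamma(A) outermost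
      on the left.\<close>
    then have inv_eq: "matrix_inv (mGamma (A + mat (of_nat m))) = G' ** P m"
      by (simp add: G'_def P_def matrix_inv_mult(2) invertible_mpochhammer[OF inv] invertible_mGamma[OF st])
    have int_eq: "T (LINT v:S|lborel. q v) = (LINT v:S|lborel. f m v)"
      unfolding lin(2)[symmetric] using S(1) by (intro set_lebesgue_integral_cong) (auto simp: eq)
    show "(t ^ m / fact m) *\<^sub>M (matrix_inv (mGamma (A + mat (of_nat m))) **
            (LINT s:S|lborel. exp (- s) *\<^sub>R mpowr s (A + mat (of_nat m) - mat 1)))
       = G' ** (LINT v:S|lborel. f m v)"
      unfolding inv_eq int_eq[symmetric]
      by (simp add: T_def q_def cscale_mult_right matrix_mul_assoc)
  qed

  define D where "D = K * C"
  have D0: "D \<ge> 0" using K0 C0 by (simp add: D_def)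
  have coeff: "norm (((of_real v * t) ^ m / fact m) *\<^sub>M P m) \<le> C * ((v / 2) ^ m / fact m)"
    if "v > 0" for v m
  proof -
    have "norm (((of_real v * t) ^ m / fact m) *\<^sub>M P m) = (v * cmod t) ^ m / fact m * norm (P m)"
      using that by (simp add: norm_cscale norm_divide norm_power norm_mult)
    also have "\<dots> \<le> (v * cmod t) ^ m / fact m * (C * \<epsilon> ^ m)"
      using that C by (intro mult_left_mono) auto
    also have "\<dots> = C * ((v * (\<epsilon> * cmod t)) ^ m / fact m)"
      by (simp add: power_mult_distrib)
    also have "\<dots> \<le> C * ((v * (1 / 2)) ^ m / fact m)"
      using that \<epsilon> C0 by (intro mult_left_mono divide_right_mono power_mono) auto
    finally show ?thesis by simp
  qed
  have expser: "(\<lambda>m. (v / 2) ^ m / fact m) sums exp (v / 2)" for v :: real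
    using exp_converges[of "v / 2"] by (simp only: real_scaleR_def divide_inverse_commute)
  have fsums: "(\<lambda>m. f m v) sums F v" if "v > 0" for v
  proof -
    have "summable (\<lambda>m. ((of_real v * t) ^ m / fact m) *\<^sub>M P m)"
      by (rule summable_comparison_test'[OF sums_summable[OF sums_mult[OF expser[of v], of C]], where N = 0])
         (use coeff[OF that] in simp)
    then have "(\<lambda>m. ((of_real v * t) ^ m / fact m) *\<^sub>M P m) sums hyp0F1 A (of_real v * t)"
      unfolding hyp0F1_def P_def by (rule summable_sums)
    then show ?thesis
      unfolding f_def F_def
      by (rule bounded_linear.sums[OF bounded_bilinear.bounded_linear_right[OF bounded_bilinear_matrix_mult]])
  qed
  \<comment> \<open>The dominating function, with exp(-v) exp(v/2) already combined; it is
    integrable by \<open>set_integrable_mGamma\<close> with c = 1/2.\<close>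
  define w where "w = (\<lambda>v. D * norm (exp (- (1 / 2 * v)) *\<^sub>R mpowr v (A - mat 1)))"
  have partial: "norm (\<Sum>m<i. f m v) \<le> w v" if "v > 0" for v i
  proof -
    have "norm (f m v) \<le> D * norm (k v) * ((v / 2) ^ m / fact m)" for m
    proof -
      have "norm (f m v) \<le> K * norm (k v) * norm (((of_real v * t) ^ m / fact m) *\<^sub>M P m)"
        unfolding f_def using K by blast
      also have "\<dots> \<le> K * norm (k v) * (C * ((v / 2) ^ m / fact m))"
        using K0 coeff[OF that] by (intro mult_left_mono) auto
      finally show ?thesis by (simp add: D_def mult_ac)
    qed
    then have "norm (\<Sum>m<i. f m v) \<le> (\<Sum>m<i. D * norm (k v) * ((v / 2) ^ m / fact m))"
      by (rule sum_norm_le)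
    also have "\<dots> = D * norm (k v) * (\<Sum>m<i. (v / 2) ^ m / fact m)"
      by (simp only: sum_distrib_left)
    also have "\<dots> \<le> D * norm (k v) * exp (v / 2)"
      using D0 that unfolding sums_unique[OF expser[of v]]
      by (intro mult_left_mono sum_le_suminf sums_summable[OF expser]) auto
    also have "\<dots> = w v"
    proof -
      have "exp (- v) * exp (v / 2) = exp (- (1 / 2 * v))" by (simp flip: exp_add)
      then show ?thesis by (simp add: w_def k_def mult_ac)
    qed
    finally show ?thesis .
  qed

  have meas: "(\<lambda>v. indicat_real S v *\<^sub>R (\<Sum>m<i. f m v)) \<in> borel_measurable lborel"
    and split: "(LINT v:S|lborel. (\<Sum>m<i. f m v)) = (\<Sum>m<i. LINT v:S|lborel. f m v)" for i
  proof -
    have i: "integrable lborel (\<lambda>v. indicat_real S v *\<^sub>R f m v)" for m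
      using termwise(1) unfolding set_integrable_def .
    have eq: "(\<lambda>v. indicat_real S v *\<^sub>R (\<Sum>m<i. f m v)) = (\<lambda>v. \<Sum>m<i. indicat_real S v *\<^sub>R f m v)"
      by (simp add: scaleR_sum_right)
    show "(\<lambda>v. indicat_real S v *\<^sub>R (\<Sum>m<i. f m v)) \<in> borel_measurable lborel"
      unfolding eq by (intro borel_measurable_integrable Bochner_Integration.integrable_sum i)
    show "(LINT v:S|lborel. (\<Sum>m<i. f m v)) = (\<Sum>m<i. LINT v:S|lborel. f m v)"
      unfolding set_lebesgue_integral_def eq by (intro Bochner_Integration.integral_sum i)
  qed
  have lim: "(\<lambda>i. indicat_real S v *\<^sub>R (\<Sum>m<i. f m v)) \<longlonglongrightarrow> indicat_real S v *\<^sub>R F v" for v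
  proof (cases "v \<in> S")
    case True
    then have "v > 0" using S by auto
    then show ?thesis using fsums unfolding sums_def by (intro tendsto_intros)
  qed simp
  have "(\<lambda>i. LINT v:S|lborel. (\<Sum>m<i. f m v)) \<longlonglongrightarrow> (LINT v:S|lborel. F v)"
    unfolding set_lebesgue_integral_def
  proof (rule integral_dominated_convergence[where w = "\<lambda>v. indicat_real S v *\<^sub>R w v"])
    \<comment> \<open>Measurability of the limit is inherited from the partial sums through
      pointwise convergence.\<close>
    show "(\<lambda>v. indicat_real S v *\<^sub>R F v) \<in> borel_measurable lborel"
      by (rule borel_measurable_LIMSEQ_metric[OF meas lim])
    have "set_integrable lborel {0<..} w"
      unfolding w_def
      by (intro set_integrable_mult_right set_integrable_norm set_integrable_mGamma st) simp
    then have "set_integrable lborel S w" by (rule set_integrable_subset[OF _ S])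
    then show "integrable lborel (\<lambda>v. indicat_real S v *\<^sub>R w v)"
      unfolding set_integrable_def .
    show "AE v in lborel. norm (indicat_real S v *\<^sub>R (\<Sum>m<i. f m v)) \<le> indicat_real S v *\<^sub>R w v" for i
      using partial S(2) by (intro always_eventually) (auto simp: indicator_def)
  qed (rule meas, auto intro: lim)
  then have "(\<lambda>m. LINT v:S|lborel. f m v) sums (LINT v:S|lborel. F v)"
    unfolding sums_def split .
  then have "(\<lambda>m. G' ** (LINT v:S|lborel. f m v)) sums (G' ** (LINT v:S|lborel. F v))"
    by (rule bounded_linear.sums[OF bounded_bilinear.bounded_linear_right[OF bounded_bilinear_matrix_mult]])
  then show ?thesis
    unfolding termwise(2) F_def k_def G'_def .
qed

theorem theorem3p1:
  fixes A :: "complex^'n^'n" and x :: real and t :: complex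
  assumes "positive_stable A"
    and "\<forall>k::nat. invertible (A + mat (of_nat k))"
    and "x > 0"
  shows
    "lower_inc_exp x t A =
       matrix_inv (mGamma A) **
       (LINT v:{0<..<x}|lborel. (exp (- v) *\<^sub>R mpowr v (A - mat 1)) **
          (\<Sum>m. ((of_real v * t) ^ m / fact m) *\<^sub>M matrix_inv (mpochhammer A m)))
     \<and> lower_inc_exp x t A =
       matrix_inv (mGamma A) **
       (LINT v:{0<..<x}|lborel. (exp (- v) *\<^sub>R mpowr v (A - mat 1)) ** hyp0F1 A (of_real v * t))
     \<and> upper_inc_exp x t A =
       matrix_inv (mGamma A) **
       (LINT v:{x<..}|lborel. (exp (- v) *\<^sub>R mpowr v (A - mat 1)) **
          (\<Sum>m. ((of_real v * t) ^ m / fact m) *\<^sub>M matrix_inv (mpochhammer A m)))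
     \<and> upper_inc_exp x t A =
       matrix_inv (mGamma A) **
       (LINT v:{x<..}|lborel. (exp (- v) *\<^sub>R mpowr v (A - mat 1)) ** hyp0F1 A (of_real v * t))"
proof -
  have "{0<..<x} \<in> sets lborel" "{0<..<x} \<subseteq> {0<..}" "{x<..} \<in> sets lborel" "{x<..} \<subseteq> {0<..}"
    using assms(3) by auto
  note * = incomplete_exp_sums[OF assms(1,2) this(1,2), of t, THEN sums_unique]
    incomplete_exp_sums[OF assms(1,2) this(3,4), of t, THEN sums_unique]
  show ?thesis
    \<comment> \<open>Once \<open>hyp0F1_def\<close> is unfolded, the two right-hand sides for each
      function coincide.\<close>
    using *[symmetric]
    unfolding lower_inc_exp_def upper_inc_exp_def lower_mGamma_def upper_mGamma_def hyp0F1_def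
    by (intro conjI)
qed

end
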